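(* Let $M\in M_n(\mathbb R)$ be an LCP-generic matrix. Then the number of LCP-aligned values of $M$, counted with multiplicity, is odd.
   Context: $M_n(\mathbb R)$ is the space of real $n\times n$ matrices and $\mathbb I$ is the identity matrix. $\mathcal S_n$ is the set of diagonal $n\times n$ matrices with all diagonal entries in $\{-1,+1\}$. An LCP-aligned trio of $M$ is a triple $(\lambda,S,v)$ with $\lambda\ge0$ real, $S\in\mathcal S_n$, $v\in\mathbb R^n_{\ge0}$, $\|v\|_2=1$, and $(M-\mathbb I)v=\lambda(M+\mathbb I)Sv$. Then $\lambda$ is called an LCP-aligned value of $M$. The multiplicity of an LCP-aligned value $\lambda$ of an LCP-generic $M$ is the number of pairs $(S,v)$ such that $(\lambda,S,v)$ is an LCP-aligned trio of $M$. A matrix $A\in M_n(\mathbb R)$ is generic if for every triple $(\lambda,S,v)$ with $\lambda\ge 0$ real, $S\in\mathcal S_n$, $v\in\mathbb R^n_{\ge 0}$, $\|v\|_2=1$ and $SAv=\lambda v$, $\lambda$ is a simple eigenvalue of $SA$ and $v$ is strictly positive (all entries $>0$). $M$ is LCP-generic if $M+\mathbb I$ is invertible and $(M+\mathbb I)^{-1}(M-\mathbb I)$ is generic.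
   Formalization: The matrix M = I is excluded: for n = 1, M = [1] is LCP-generic, yet its only LCP-aligned value is 0 with multiplicity 2, an even count; for n ≥ 2, I is never LCP-generic, so no other case is lost. *)

theory Defs
  imports "HOL-Analysis.Analysis" "HOL-Computational_Algebra.Polynomial"
begin

definition sign_matrices :: "(real ^ 'n ^ 'n) set" where
  "sign_matrices =
     {S. (\<forall>i j. i \<noteq> j \<longrightarrow> S $ i $ j = 0) \<and> (\<forall>i. S $ i $ i \<in> {-1, 1})}"

(* det (X I - A), with the determinant taken over the polynomial ring real poly *)
definition charpoly :: "real ^ 'n ^ 'n \<Rightarrow> real poly" where
  "charpoly A = det (mat [:0, 1:] - (\<chi> i j. [:A $ i $ j:]))"

(* simple means algebraic multiplicity one *)
definition simple_eigenvalue :: "real ^ 'n ^ 'n \<Rightarrow> real \<Rightarrow> bool" where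
  "simple_eigenvalue A \<mu> \<longleftrightarrow> order \<mu> (charpoly A) = 1"

definition generic :: "real ^ 'n ^ 'n \<Rightarrow> bool" where
  "generic A \<longleftrightarrow>
     (\<forall>\<mu> S v. \<mu> \<ge> 0 \<and> S \<in> sign_matrices \<and> (\<forall>i. v $ i \<ge> 0) \<and> norm v = 1 \<and>
        (S ** A) *v v = \<mu> *\<^sub>R v
      \<longrightarrow> simple_eigenvalue (S ** A) \<mu> \<and> (\<forall>i. v $ i > 0))"

definition lcp_generic :: "real ^ 'n ^ 'n \<Rightarrow> bool" where
  "lcp_generic M \<longleftrightarrow>
     invertible (M + mat 1) \<and> generic (matrix_inv (M + mat 1) ** (M - mat 1))"

(* mat 1 is lcp_generic exactly in dimension one: there 0 is its only aligned value, with
   the two pairs (mat 1, vec 1) and (- mat 1, vec 1), so its count is 2 and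
   the parity theorem has to exclude this matrix *)

definition lcp_aligned_trio ::
  "real ^ 'n ^ 'n \<Rightarrow> real \<Rightarrow> real ^ 'n ^ 'n \<Rightarrow> real ^ 'n \<Rightarrow> bool" where
  "lcp_aligned_trio M \<mu> S v \<longleftrightarrow>
     \<mu> \<ge> 0 \<and> S \<in> sign_matrices \<and> (\<forall>i. v $ i \<ge> 0) \<and> norm v = 1 \<and>
     (M - mat 1) *v v = \<mu> *\<^sub>R ((M + mat 1) *v (S *v v))"

definition lcp_aligned_values :: "real ^ 'n ^ 'n \<Rightarrow> real set" where
  "lcp_aligned_values M = {\<mu>. \<exists>S v. lcp_aligned_trio M \<mu> S v}"

definition lcp_aligned_pairs ::
  "real ^ 'n ^ 'n \<Rightarrow> real \<Rightarrow> ((real ^ 'n ^ 'n) \<times> (real ^ 'n)) set" where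
  "lcp_aligned_pairs M \<mu> = {(S, v). lcp_aligned_trio M \<mu> S v}"

(* card is 0 on infinite sets, so this is the multiplicity only when
   lcp_aligned_pairs M \<mu> is finite *)
definition lcp_multiplicity :: "real ^ 'n ^ 'n \<Rightarrow> real \<Rightarrow> nat" where
  "lcp_multiplicity M \<mu> = card (lcp_aligned_pairs M \<mu>)"

end

theory Submission
  imports Defs "HOL-Library.Z2" "HOL-Library.Disjoint_Sets"
begin

text \<open>
  With \<open>A = (M + I)\<^sup>-\<^sup>1 (M - I)\<close> the aligned trios are the nonnegative unit kernel vectors of the
  pencils \<open>t S - A\<close>. Fix a generic right-hand side \<open>y\<close> and let \<open>N(t)\<close> be the number of sign
  matrices \<open>S\<close> for which \<open>(t S - A) x = y\<close> has a strictly positive solution. For each \<open>S\<close> this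
  solution is a rational function of \<open>t\<close>. If one of its coordinates vanishes at some \<open>t\<close>, the same
  happens for the sign matrix that differs from \<open>S\<close> in this coordinate, and the two changes of \<open>N\<close>
  cancel modulo 2. A simple pole with an aligned kernel vector makes \<open>S\<close> count on exactly one side
  of the pole, and no other pole matters. Hence the parity of \<open>N\<close> changes by the number
  of aligned trios passed. Finally \<open>N(t) = 1\<close> for large \<open>t\<close>, and \<open>N(t)\<close> is even as \<open>t\<close> decreases
  to 0: either all sign matrices count, or none, or (if 0 is an aligned value) exactly one of
  each pair \<open>S\<close>, \<open>-S\<close>.
\<close>

section \<open>Diagonal sign pencils\<close>

text \<open>A sign matrix is encoded by the set of indices with entry -1. These sets form a finite
  type, so eventual statements hold uniformly over all sign patterns and patterns can be counted
  with \<open>card\<close>.\<close>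

definition sign_at :: "'n set \<Rightarrow> 'n \<Rightarrow> real" where
  "sign_at T i = (if i \<in> T then -1 else 1)"

definition pencil :: "real ^ 'n ^ 'n \<Rightarrow> 'n set \<Rightarrow> real \<Rightarrow> real ^ 'n ^ 'n" where
  "pencil A T t = (\<chi> i j. (if i = j then t * sign_at T i else 0) - A $ i $ j)"

definition det_poly :: "real ^ 'n ^ 'n \<Rightarrow> 'n set \<Rightarrow> real poly" where
  "det_poly A T = det (\<chi> i j. [:- A $ i $ j, if i = j then sign_at T i else 0:])"

text \<open>The numerator in Cramer's rule for the system with matrix \<open>pencil A T t\<close>
  and right-hand side \<open>y\<close>. As a polynomial in \<open>t\<close> it can also be evaluated
  where the determinant vanishes.\<close>

definition cramer_poly :: "real ^ 'n ^ 'n \<Rightarrow> real ^ 'n \<Rightarrow> 'n set \<Rightarrow> 'n \<Rightarrow> real poly" where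
  "cramer_poly A y T k =
     det (\<chi> i j. if j = k then [:y $ i:]
                 else [:- A $ i $ j, if i = j then sign_at T i else 0:])"

lemma abs_sign_at [simp]: "\<bar>sign_at T i\<bar> = 1"
  by (simp add: sign_at_def)

lemma poly_det: "poly (det B) t = det (\<chi> i j. poly (B $ i $ j) t)"
  unfolding det_def by (simp add: poly_sum poly_prod of_int_poly)

lemma pencil_mult_nth: "(pencil A T t *v x) $ i = t * sign_at T i * x $ i - (A *v x) $ i"
proof -
  have "(pencil A T t *v x) $ i
      = (\<Sum>j\<in>UNIV. (if i = j then t * sign_at T i else 0) * x $ j) - (A *v x) $ i"
    by (simp add: pencil_def matrix_vector_mult_def left_diff_distrib sum_subtractf)
  also have "(\<Sum>j\<in>UNIV. (if i = j then t * sign_at T i else 0) * x $ j)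
      = (\<Sum>j\<in>UNIV. if j = i then t * sign_at T i * x $ i else 0)"
    by (rule sum.cong) auto
  finally show ?thesis by simp
qed

lemma poly_det_poly: "poly (det_poly A T) t = det (pencil A T t)"
  unfolding det_poly_def poly_det pencil_def
  by (rule arg_cong[where f = det]) (simp add: vec_eq_iff)

lemma poly_cramer_poly:
  "poly (cramer_poly A y T k) t = det (\<chi> i j. if j = k then y $ i else pencil A T t $ i $ j)"
  unfolding cramer_poly_def poly_det pencil_def
  by (rule arg_cong[where f = det]) (simp add: vec_eq_iff)

lemma pencil_solve:
  assumes "det (pencil A T t) \<noteq> 0"
  shows "pencil A T t *v x = y \<longleftrightarrow> x = (\<chi> k. poly (cramer_poly A y T k) t / poly (det_poly A T) t)"
  unfolding poly_cramer_poly poly_det_poly by (rule cramer[OF assms])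

section \<open>Nonsingularity and solution signs at large parameters\<close>

lemma det_nonzero_iff_kernel:
  fixes B :: "real ^ 'n ^ 'n"
  shows "det B \<noteq> 0 \<longleftrightarrow> (\<forall>x. B *v x = 0 \<longrightarrow> x = 0)"
  by (metis invertible_det_nz invertible_left_inverse matrix_left_invertible_ker)

text \<open>This is the triangle inequality for \<open>t S x = A x + (t S - A) x\<close>, where the
  sign matrix \<open>S\<close> is an isometry.\<close>

lemma norm_pencil_lower_bound:
  "\<bar>t\<bar> * norm x \<le> norm (A *v x) + norm (pencil A T t *v x)"
proof -
  define z where "z = (\<chi> j. sign_at T j * x $ j)"
  have "t *\<^sub>R z = A *v x + pencil A T t *v x"
    by (simp add: vec_eq_iff pencil_mult_nth z_def mult.assoc)
  moreover have "norm z = norm x"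
    unfolding norm_vec_def z_def by (rule L2_set_cong) (auto simp: abs_mult)
  ultimately show ?thesis
    using norm_triangle_ineq[of "A *v x" "pencil A T t *v x"] by (metis norm_scaleR)
qed

text \<open>With \<open>K\<close> bounding the operator norm of \<open>A\<close> and
  \<open>t > K\<close>, a solution has norm at most \<open>norm y / (t - K)\<close>. Eventually
  \<open>A x\<close> is therefore smaller than a nonzero entry of \<open>y\<close>, and
  \<open>t S x = A x + y\<close> takes the sign of that entry.\<close>

lemma eventually_pencil_large:
  fixes A :: "real ^ 'n ^ 'n"
  shows "\<forall>\<^sub>F t in at_top. \<forall>T x i. pencil A T t *v x = y \<longrightarrow> y $ i \<noteq> 0
           \<longrightarrow> sign_at T i * x $ i * y $ i > 0"
proof -
  obtain K where K: "K > 0" "\<And>x. norm (A *v x) \<le> norm x * K"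
    using bounded_linear.pos_bounded[OF matrix_vector_mul_bounded_linear[of A]] by blast
  have ev: "\<forall>\<^sub>F t in at_top. y $ i \<noteq> 0 \<longrightarrow> t > K \<and> K * norm y < (t - K) * \<bar>y $ i\<bar>" for i
  proof (cases "y $ i = 0")
    case False
    have "\<forall>\<^sub>F t in at_top. t > K + K * norm y / \<bar>y $ i\<bar>" by (rule eventually_gt_at_top)
    moreover have "\<forall>\<^sub>F t in at_top. t > K" by (rule eventually_gt_at_top)
    ultimately show ?thesis
    proof eventually_elim
      case (elim t)
      then show ?case using False by (simp add: field_simps)
    qed
  qed simp
  have "\<forall>\<^sub>F t in at_top. \<forall>i. y $ i \<noteq> 0 \<longrightarrow> t > K \<and> K * norm y < (t - K) * \<bar>y $ i\<bar>"
    by (rule eventually_all_finite) (rule ev)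
  then show ?thesis
  proof eventually_elim
    case (elim t)
    show ?case
    proof (intro allI impI)
      fix T x i assume eq: "pencil A T t *v x = y" and yi: "y $ i \<noteq> 0"
      have t: "t > K" and ti: "K * norm y < (t - K) * \<bar>y $ i\<bar>" using elim yi by blast+
      have "(t - K) * norm x \<le> norm y"
        using norm_pencil_lower_bound[of t x A T] K(2)[of x] t K(1) by (simp add: eq algebra_simps)
      then have "(t - K) * (norm x * K) \<le> K * norm y"
        using K(1) by (metis mult.assoc mult.commute mult_left_mono less_imp_le)
      then have "(t - K) * (norm x * K) < (t - K) * \<bar>y $ i\<bar>" using ti by linarith
      then have "norm x * K < \<bar>y $ i\<bar>" using t by (simp add: mult_less_cancel_left_pos)
      then have small: "\<bar>(A *v x) $ i\<bar> < \<bar>y $ i\<bar>"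
        using K(2)[of x] component_le_norm_cart[of "A *v x" i] by linarith
      have "t * (sign_at T i * x $ i * y $ i) = ((A *v x) $ i + y $ i) * y $ i"
        using pencil_mult_nth[of A T t x i] by (simp add: eq algebra_simps)
      moreover have "((A *v x) $ i + y $ i) * y $ i > 0"
        using small by (cases "y $ i > 0") (auto intro: mult_pos_pos mult_neg_neg)
      ultimately show "sign_at T i * x $ i * y $ i > 0"
        using t K(1) by (metis less_trans zero_less_mult_pos)
    qed
  qed
qed

lemma eventually_det_pencil_nonzero:
  fixes A :: "real ^ 'n ^ 'n"
  shows "\<forall>\<^sub>F t in at_top. \<forall>T. det (pencil A T t) \<noteq> 0"
proof -
  obtain K where K: "K > 0" "\<And>x. norm (A *v x) \<le> norm x * K"
    using bounded_linear.pos_bounded[OF matrix_vector_mul_bounded_linear[of A]] by blast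
  show ?thesis
  proof (rule eventually_mono[OF eventually_gt_at_top[of K]], rule allI)
    fix t T assume t: "K < t"
    have "x = 0" if eq: "pencil A T t *v x = 0" for x
    proof -
      have "t * norm x \<le> K * norm x"
        using norm_pencil_lower_bound[of t x A T] K(2)[of x] t K(1) by (simp add: eq mult.commute)
      then show ?thesis using t by (simp add: mult_le_cancel_right)
    qed
    then show "det (pencil A T t) \<noteq> 0" by (simp add: det_nonzero_iff_kernel)
  qed
qed

lemma det_poly_nonzero: "det_poly A T \<noteq> 0"
proof
  assume "det_poly A T = 0"
  then have "det (pencil A T t) = 0" for t by (metis poly_det_poly poly_0)
  then show False
    using eventually_happens[OF eventually_det_pencil_nonzero[of A]] by (metis trivial_limit_at_top_linorder)
qed

text \<open>For large \<open>t\<close> coordinate \<open>k\<close> of the solution has the sign of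
  \<open>sign_at T k * y $ k\<close>, so its numerator cannot vanish identically.\<close>

lemma cramer_poly_nonzero:
  assumes "y $ k \<noteq> 0"
  shows "cramer_poly A y T k \<noteq> 0"
proof
  assume 0: "cramer_poly A y T k = 0"
  obtain t where d: "det (pencil A T t) \<noteq> 0"
    and p: "\<And>x. pencil A T t *v x = y \<Longrightarrow> sign_at T k * x $ k * y $ k > 0"
    using eventually_happens[OF eventually_conj[OF eventually_det_pencil_nonzero[of A]
          eventually_pencil_large[of A y]]] assms by auto
  show False
    using p[OF pencil_solve[OF d, THEN iffD2, OF refl]] by (simp add: 0)
qed

text \<open>Compactness also catches solutions that escape to infinity as \<open>s\<close> tends to
  \<open>t\<close>. The system is homogenised to \<open>pencil A T s *v u = r *\<^sub>R y\<close>
  with nonnegative \<open>(u, r)\<close> on the unit sphere: \<open>r > 0\<close> encodes a solution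
  and \<open>r = 0\<close> a kernel vector, and the assumptions exclude both at \<open>t\<close>.
  The parameters admitting such a pair are a projection of a compact set, hence closed.\<close>

lemma eventually_no_nonneg_solution:
  fixes A :: "real ^ 'n ^ 'n"
  assumes "\<And>x. (\<forall>i. x $ i \<ge> 0) \<Longrightarrow> pencil A T t *v x \<noteq> y"
    and "\<And>x. (\<forall>i. x $ i \<ge> 0) \<Longrightarrow> norm x = 1 \<Longrightarrow> pencil A T t *v x \<noteq> 0"
  shows "\<forall>\<^sub>F s in nhds t. \<forall>x. (\<forall>i. x $ i \<ge> 0) \<longrightarrow> pencil A T s *v x \<noteq> y"
proof -
  define G where "G = {(s, u, r). s \<in> cball t 1 \<and> (u, r) \<in> sphere (0 :: (real^'n) \<times> real) 1
      \<and> (\<forall>i. u $ i \<ge> 0) \<and> r \<ge> 0 \<and> pencil A T s *v u = r *\<^sub>R y}"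
  have "G = (cball t 1 \<times> sphere 0 1) \<inter>
      (\<Inter>i. {p. 0 \<le> fst (snd p) $ i} \<inter> {p. 0 \<le> snd (snd p)} \<inter>
         {p. fst p * sign_at T i * fst (snd p) $ i - (A *v fst (snd p)) $ i = snd (snd p) * y $ i})"
    unfolding G_def by (auto simp: vec_eq_iff pencil_mult_nth)
  also have "compact \<dots>"
    by (intro compact_Int_closed compact_Times compact_cball compact_sphere closed_INT ballI
        closed_Int closed_Collect_le closed_Collect_eq)
       (auto intro!: continuous_intros continuous_on_compose2[OF matrix_vector_mult_linear_continuous_on])
  finally have "compact G" .
  then have cl: "closed (fst ` G)"
    by (intro compact_imp_closed compact_continuous_image) (auto intro: continuous_intros)
  have "t \<notin> fst ` G"
  proof
    assume "t \<in> fst ` G"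
    then obtain u r where u: "norm (u, r) = 1" "\<forall>i. u $ i \<ge> 0" "r \<ge> 0" "pencil A T t *v u = r *\<^sub>R y"
      by (auto simp: G_def)
    show False
    proof (cases "r = 0")
      case True
      then show False using u assms(2)[of u] by (simp add: norm_Pair)
    next
      case False
      then have "pencil A T t *v ((1 / r) *\<^sub>R u) = y"
        using u(4) by (simp add: matrix_vector_mult_scaleR)
      then show False using u assms(1)[of "(1 / r) *\<^sub>R u"] by simp
    qed
  qed
  then have "\<forall>\<^sub>F s in nhds t. s \<in> - fst ` G"
    using cl by (intro eventually_nhds_in_open) auto
  moreover have "\<forall>\<^sub>F s in nhds t. s \<in> ball t 1"
    by (intro eventually_nhds_in_open) auto
  ultimately show ?thesis
  proof eventually_elim
    case (elim s)
    show ?case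
    proof (intro allI impI notI)
      fix x assume x: "\<forall>i. x $ i \<ge> 0" "pencil A T s *v x = y"
      \<comment> \<open>Dividing \<open>(x, 1)\<close> by its norm turns a solution into a point of
        the homogeneous set \<open>G\<close>.\<close>
      define c where "c = norm (x, 1 :: real)"
      have c: "c > 0" by (simp add: c_def norm_Pair add_nonneg_pos)
      have "(s, (1 / c) *\<^sub>R x, 1 / c) \<in> G"
      proof -
        have "norm ((1 / c) *\<^sub>R (x, 1 :: real)) = 1"
          unfolding norm_scaleR c_def[symmetric] using c by simp
        then show ?thesis using elim x c by (auto simp: G_def matrix_vector_mult_scaleR simp del: norm_scaleR)
      qed
      then show False using elim by force
    qed
  qed
qed

section \<open>Signs of polynomials and generic right-hand sides\<close>

text \<open>In the field \<open>bit\<close> the terms for \<open>x\<close> and \<open>h x\<close>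
  cancel, and a natural number is zero there exactly when it is even.\<close>

lemma even_card_fixpoint_free_involution:
  assumes "\<And>x. x \<in> X \<Longrightarrow> h x \<in> X" "\<And>x. x \<in> X \<Longrightarrow> h (h x) = x" "\<And>x. x \<in> X \<Longrightarrow> h x \<noteq> x"
  shows "even (card X)"
proof -
  have "(\<Sum>x\<in>X. 1 :: bit) = 0"
    by (rule sum_involution_eq_0[where h = h]) (use assms in auto)
  moreover have "of_nat n = (0 :: bit) \<longleftrightarrow> even n" for n
    by (induction n) auto
  ultimately show ?thesis by simp
qed

section \<open>Signs of real polynomials on one side of a point\<close>

lemma poly_pos_const_on_interval:
  fixes p :: "real poly"
  assumes "\<And>t. a < t \<Longrightarrow> t < b \<Longrightarrow> poly p t \<noteq> 0" "a < s" "s < b" "a < t" "t < b"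
  shows "poly p s > 0 \<longleftrightarrow> poly p t > 0"
proof (cases s t rule: linorder_cases)
  case less
  then show ?thesis
    using poly_IVT_pos[of s t p] poly_IVT_neg[of s t p] assms
    by (meson less_trans linorder_neqE_linordered_idom)
next
  case greater
  then show ?thesis
    using poly_IVT_pos[of t s p] poly_IVT_neg[of t s p] assms
    by (meson less_trans linorder_neqE_linordered_idom)
qed simp

lemma eventually_poly_nonzero:
  fixes p :: "real poly"
  assumes "p \<noteq> 0"
  shows "\<forall>\<^sub>F t in at c. poly p t \<noteq> 0"
  using islimpt_finite[OF poly_roots_finite[OF assms], of c]
  by (simp add: islimpt_iff_eventually)

text \<open>A nonzero polynomial has no root on a short interval on either side of \<open>c\<close>,
  so its sign is constant there.\<close>

lemma poly_eventually_pos_or_not: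
  fixes p :: "real poly"
  assumes "F = at_left c \<or> F = at_right c"
  shows "(\<forall>\<^sub>F t in F. poly p t > 0) \<or> (\<forall>\<^sub>F t in F. \<not> poly p t > 0)"
proof (cases "p = 0")
  case False
  have "\<forall>\<^sub>F t in F. poly p t \<noteq> 0"
    using eventually_poly_nonzero[OF False, of c] assms unfolding eventually_at_split by auto
  then have "\<exists>a b. a < b \<and> (\<forall>t. a < t \<longrightarrow> t < b \<longrightarrow> poly p t \<noteq> 0) \<and> (\<forall>\<^sub>F t in F. a < t \<and> t < b)"
    using assms
  proof (elim disjE)
    assume F: "F = at_left c" and "\<forall>\<^sub>F t in F. poly p t \<noteq> 0"
    then obtain a where "a < c" "\<forall>t>a. t < c \<longrightarrow> poly p t \<noteq> 0"
      by (auto simp: eventually_at_left_field)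
    moreover from this have "\<forall>\<^sub>F t in F. a < t \<and> t < c"
      unfolding F eventually_at_left_field by auto
    ultimately show ?thesis by blast
  next
    assume F: "F = at_right c" and "\<forall>\<^sub>F t in F. poly p t \<noteq> 0"
    then obtain b where "c < b" "\<forall>t>c. t < b \<longrightarrow> poly p t \<noteq> 0"
      by (auto simp: eventually_at_right_field)
    moreover from this have "\<forall>\<^sub>F t in F. c < t \<and> t < b"
      unfolding F eventually_at_right_field by auto
    ultimately show ?thesis by blast
  qed
  then obtain a b where ab: "a < b" "\<And>t. a < t \<Longrightarrow> t < b \<Longrightarrow> poly p t \<noteq> 0"
    "\<forall>\<^sub>F t in F. a < t \<and> t < b" by blast
  define m where "m = (a + b) / 2"
  have m: "a < m" "m < b" using ab(1) by (auto simp: m_def)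
  show ?thesis
  proof (cases "poly p m > 0")
    case True
    have "\<forall>\<^sub>F t in F. poly p t > 0"
      using ab(3) by eventually_elim (use True m poly_pos_const_on_interval[OF ab(2)] in blast)
    then show ?thesis ..
  next
    case False
    have "\<forall>\<^sub>F t in F. \<not> poly p t > 0"
      using ab(3) by eventually_elim (use False m poly_pos_const_on_interval[OF ab(2)] in blast)
    then show ?thesis ..
  qed
qed simp

text \<open>The inner quantifier is a truth value independent of the outer \<open>s\<close>. A
  condition that settles along \<open>F\<close> can thus be replaced by its limit value, which is
  how \<open>solvable_right\<close> and \<open>solvable_left\<close> are formed.\<close>

lemma eventually_eq_eventually:
  assumes "(\<forall>\<^sub>F s in F. P s) \<or> (\<forall>\<^sub>F s in F. \<not> P s)"
  shows "\<forall>\<^sub>F s in F. P s \<longleftrightarrow> (\<forall>\<^sub>F s in F. P s)"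
  using assms by (cases "\<forall>\<^sub>F s in F. P s") auto

section \<open>Right-hand sides outside a null set\<close>

lemma negligible_UNION:
  assumes "finite I" "\<And>i. i \<in> I \<Longrightarrow> negligible (S i)"
  shows "negligible (\<Union>i\<in>I. S i)"
  using assms by (intro negligible_Union) auto

text \<open>Each requirement fails only for \<open>y\<close> in a null set: a hyperplane, the range
  of one of finitely many singular pencils, the image of a hyperplane under \<open>A\<close>, or,
  for solutions with two zero coordinates, a differentiable image of a hyperplane.\<close>

lemma ex_generic_vector:
  fixes A :: "real ^ 'n ^ 'n"
  shows "\<exists>y. (\<forall>i. y $ i \<noteq> 0)
    \<and> (\<forall>T t x i j. pencil A T t *v x = y \<longrightarrow> x $ i = 0 \<longrightarrow> x $ j = 0 \<longrightarrow> i = j)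
    \<and> (\<forall>T t x. pencil A T t *v x = y \<longrightarrow> det (pencil A T t) \<noteq> 0)
    \<and> (\<forall>x i. A *v x = y \<longrightarrow> x $ i \<noteq> 0)"
proof -
  define H where "H j = {z :: real ^ 'n. z $ j = 0}" for j
  \<comment> \<open>Since coordinate \<open>i\<close> of the solution is zero, slot \<open>i\<close>
    of \<open>z\<close> is free to carry the parameter \<open>t\<close>. A second zero coordinate
    \<open>j\<close> confines \<open>z\<close> to the null set \<open>H j\<close>.\<close>
  define f where "f T i z = (\<chi> k. z $ i * sign_at T k * (if k = i then 0 else z $ k)
      - (A *v (\<chi> l. if l = i then 0 else z $ l)) $ k)" for T i and z :: "real ^ 'n"
  define roots where "roots T = {t. poly (det_poly A T) t = 0}" for T
  define Bad where "Bad = (\<Union>i. H i) \<union> (\<Union>T. \<Union>i. \<Union>j. f T i ` H j)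
      \<union> (\<Union>T. \<Union>t\<in>roots T. range ((*v) (pencil A T t))) \<union> (\<Union>i. (*v) A ` H i)"
  have H: "negligible (H j)" for j unfolding H_def by (rule negligible_standard_hyperplane_cart)
  have fd: "f T i differentiable_on S" for T i S
  proof -
    have "(\<lambda>z. f T i z $ k) differentiable at u within S" for k u
    proof -
      have coord: "(\<lambda>z :: real ^ 'n. z $ l) differentiable at u within S" for l
        by (intro bounded_linear_imp_differentiable bounded_linear_vec_nth)
      have mask: "(\<lambda>z :: real ^ 'n. if l = i then 0 else z $ l) differentiable at u within S" for l
        by (cases "l = i") (simp_all add: coord)
      show ?thesis
        unfolding f_def matrix_vector_mult_def vec_lambda_beta
        by (intro differentiable_diff differentiable_mult differentiable_sum ballI
            differentiable_const coord mask finite)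
    qed
    then show ?thesis
      unfolding differentiable_on_def
      by (auto simp: differentiable_componentwise_within[of "f T i"] Basis_vec_def inner_axis)
  qed
  have lin: "linear ((*v) B)" for B :: "real ^ 'n ^ 'n" by simp
  have 2: "negligible (f T i ` H j)" for T i j
    by (rule negligible_differentiable_image_negligible) (auto intro: H fd)
  have 3: "negligible (range ((*v) (pencil A T t)))" if "t \<in> roots T" for T t
  proof (rule negligible_linear_singular_image[OF lin])
    have "\<exists>x\<noteq>0. pencil A T t *v x = 0"
      using that det_nonzero_iff_kernel[of "pencil A T t"] by (auto simp: roots_def poly_det_poly)
    then show "\<not> inj ((*v) (pencil A T t))"
      by (metis injD matrix_vector_mult_0_right)
  qed
  have 4: "negligible ((*v) A ` H i)" for i
    by (rule negligible_differentiable_image_negligible)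
       (auto intro: H linear_imp_differentiable_on lin)
  have roots: "finite (roots T)" for T
    unfolding roots_def by (rule poly_roots_finite[OF det_poly_nonzero])
  have "negligible (\<Union>i. H i)" by (intro negligible_UNION H finite)
  moreover have "negligible (\<Union>T. \<Union>i. \<Union>j. f T i ` H j)"
    by (intro negligible_UNION 2 finite)
  moreover have "negligible (\<Union>T. \<Union>t\<in>roots T. range ((*v) (pencil A T t)))"
    by (intro negligible_UNION 3 finite roots)
  moreover have "negligible (\<Union>i. (*v) A ` H i)"
    by (intro negligible_UNION 4 finite)
  ultimately have "negligible Bad"
    unfolding Bad_def by (intro negligible_Un)
  then obtain y where y: "y \<notin> Bad"
    by (metis UNIV_eq_I non_negligible_UNIV)
  show ?thesis
  proof (intro exI[of _ y] conjI allI impI)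
    show "y $ i \<noteq> 0" for i using y by (auto simp: Bad_def H_def)
    show "det (pencil A T t) \<noteq> 0" if "pencil A T t *v x = y" for T t x
    proof
      assume "det (pencil A T t) = 0"
      then have "t \<in> roots T" by (simp add: roots_def poly_det_poly)
      then have "y \<in> (\<Union>T. \<Union>t\<in>roots T. range ((*v) (pencil A T t)))"
        using that by (intro UN_I[of T] UN_I[of t] UNIV_I range_eqI) auto
      then show False using y by (simp add: Bad_def)
    qed
    show "x $ i \<noteq> 0" if "A *v x = y" for x i
      using y that by (auto simp: Bad_def H_def)
    show "i = j" if eq: "pencil A T t *v x = y" and i: "x $ i = 0" and j: "x $ j = 0" for T t x i j
    proof (rule ccontr)
      assume ne: "i \<noteq> j"
      define z where "z = (\<chi> k. if k = i then t else x $ k)"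
      have z: "z \<in> H j" using ne j by (simp add: H_def z_def)
      have mask: "(\<chi> l. if l = i then 0 else z $ l) = x"
        using i by (auto simp: z_def vec_eq_iff)
      have zi: "z $ i = t" "\<And>k. k \<noteq> i \<Longrightarrow> z $ k = x $ k" by (simp_all add: z_def)
      have "f T i z = y"
        unfolding f_def mask eq[symmetric] using i by (auto simp: vec_eq_iff pencil_mult_nth zi)
      then have "y \<in> f T i ` H j" using z by blast
      then show False using y by (auto simp: Bad_def)
    qed
  qed
qed

section \<open>Positive solutions along the pencil\<close>

definition flip :: "'n \<Rightarrow> 'n set \<Rightarrow> 'n set" where
  "flip i T = (if i \<in> T then T - {i} else insert i T)"

lemma flip_flip [simp]: "flip i (flip i T) = T"
  by (auto simp: flip_def)

lemma flip_neq: "flip i T \<noteq> T"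
  by (auto simp: flip_def)

lemma sign_at_flip: "j \<noteq> i \<Longrightarrow> sign_at (flip i T) j = sign_at T j"
  by (auto simp: flip_def sign_at_def)

lemma pencil_flip_mult: "x $ i = 0 \<Longrightarrow> pencil A (flip i T) t *v x = pencil A T t *v x"
  unfolding vec_eq_iff pencil_mult_nth by (metis mult_zero_right sign_at_flip)

text \<open>The sign of coordinate \<open>i\<close> enters the pencil only in column \<open>i\<close>, which Cramer's rule overwrites.\<close>

lemma cramer_poly_flip: "cramer_poly A y (flip i T) i = cramer_poly A y T i"
  unfolding cramer_poly_def
  by (rule arg_cong[where f = det]) (auto simp: vec_eq_iff sign_at_flip)

text \<open>The first two assumptions restate genericity of \<open>A\<close> for the pencil. The
  others describe \<open>y\<close> and are met by the vector from
  \<open>ex_generic_vector\<close>.\<close>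

locale generic_pencil =
  fixes A :: "real ^ 'n ^ 'n" and y :: "real ^ 'n"
  assumes kernel_pos: "\<lbrakk>t \<ge> 0; \<And>j. v $ j \<ge> 0; v \<noteq> 0; pencil A T t *v v = 0\<rbrakk> \<Longrightarrow> v $ i > 0"
    and kernel_simple: "\<lbrakk>t \<ge> 0; \<And>j. v $ j \<ge> 0; v \<noteq> 0; pencil A T t *v v = 0\<rbrakk>
          \<Longrightarrow> order t (det_poly A T) = 1"
    and y_nonzero: "y $ i \<noteq> 0"
    and one_zero: "\<lbrakk>pencil A T t *v x = y; x $ i = 0; x $ j = 0\<rbrakk> \<Longrightarrow> i = j"
    and det_nonzero: "pencil A T t *v x = y \<Longrightarrow> det (pencil A T t) \<noteq> 0"
    and preimage_nonzero: "A *v x = y \<Longrightarrow> x $ i \<noteq> 0"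
begin

text \<open>Recording the sign patterns alone is enough for counting: for \<open>t \<ge> 0\<close>
  the kernel is a line by \<open>kernel_unique\<close>, so each pattern carries a single nonnegative
  unit vector.\<close>

definition aligned :: "real \<Rightarrow> 'n set set" where
  "aligned t = {T. \<exists>v. (\<forall>i. v $ i \<ge> 0) \<and> v \<noteq> 0 \<and> pencil A T t *v v = 0}"

definition solvable :: "real \<Rightarrow> 'n set set" where
  "solvable t = {T. \<exists>x. (\<forall>i. x $ i > 0) \<and> pencil A T t *v x = y}"

definition solvable_right :: "real \<Rightarrow> 'n set set" where
  "solvable_right t = {T. \<forall>\<^sub>F s in at_right t. T \<in> solvable s}"

definition solvable_left :: "real \<Rightarrow> 'n set set" where
  "solvable_left t = {T. \<forall>\<^sub>F s in at_left t. T \<in> solvable s}"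

text \<open>Subtracting from \<open>w\<close> the largest multiple of \<open>v\<close> that leaves
  no negative coordinate gives a nonnegative kernel vector with a zero coordinate, which
  \<open>kernel_pos\<close> forces to vanish.\<close>

lemma kernel_unique:
  assumes t: "t \<ge> 0" and v: "\<And>i. v $ i \<ge> 0" "v \<noteq> 0" "pencil A T t *v v = 0"
    and w: "pencil A T t *v w = 0"
  obtains c where "w = c *\<^sub>R v"
proof -
  have pos: "v $ i > 0" for i using kernel_pos[OF t v] .
  define c where "c = Min (range (\<lambda>i. w $ i / v $ i))"
  have le: "c \<le> w $ i / v $ i" for i unfolding c_def by (intro Min_le) auto
  have "c \<in> range (\<lambda>i. w $ i / v $ i)" unfolding c_def by (intro Min_in) auto
  then obtain k where k: "c = w $ k / v $ k" by blast
  define u where "u = w - c *\<^sub>R v"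
  have "u $ i \<ge> 0" for i using le[of i] pos[of i] by (simp add: u_def field_simps)
  moreover have "u $ k = 0" using k pos[of k] by (simp add: u_def)
  moreover have "pencil A T t *v u = 0"
    by (simp add: u_def matrix_vector_mult_diff_distrib matrix_vector_mult_scaleR v w)
  ultimately have "u = 0" using kernel_pos[OF t, of u T k] by force
  then show thesis using that[of c] by (simp add: u_def)
qed

text \<open>A quotient is positive exactly when the product of numerator and denominator is, so
  solvability becomes a finite conjunction of polynomial sign conditions.\<close>

lemma solvable_iff:
  assumes "det (pencil A T t) \<noteq> 0"
  shows "T \<in> solvable t \<longleftrightarrow> (\<forall>i. poly (cramer_poly A y T i * det_poly A T) t > 0)"
  using assms
  by (simp add: solvable_def pencil_solve poly_det_poly zero_less_divide_iff zero_less_mult_iff)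

section \<open>One-sided limits of the set of solvable sign patterns\<close>

lemma eventually_det_nonzero_at: "\<forall>\<^sub>F s in at t. det (pencil A T s) \<noteq> 0"
  using eventually_poly_nonzero[OF det_poly_nonzero] by (simp add: poly_det_poly)

lemma at_one_sided_le_at: "F = at_left t \<or> F = at_right t \<Longrightarrow> F \<le> at (t :: real)"
  by (auto intro: at_le)

lemma eventually_solvable_or_not:
  assumes F: "F = at_left t \<or> F = at_right t"
  shows "(\<forall>\<^sub>F s in F. T \<in> solvable s) \<or> (\<forall>\<^sub>F s in F. T \<notin> solvable s)"
proof -
  let ?p = "\<lambda>i. cramer_poly A y T i * det_poly A T"
  have nz: "\<forall>\<^sub>F s in F. det (pencil A T s) \<noteq> 0"
    using eventually_det_nonzero_at at_one_sided_le_at[OF F] by (rule filter_leD[rotated])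
  show ?thesis
  proof (cases "\<forall>i. \<forall>\<^sub>F s in F. poly (?p i) s > 0")
    case True
    then have "\<forall>\<^sub>F s in F. \<forall>i. poly (?p i) s > 0" by (intro eventually_all_finite) blast
    with nz have "\<forall>\<^sub>F s in F. T \<in> solvable s"
      by eventually_elim (simp add: solvable_iff)
    then show ?thesis ..
  next
    case False
    then obtain i where "\<forall>\<^sub>F s in F. \<not> poly (?p i) s > 0"
      using poly_eventually_pos_or_not[OF F] by blast
    with nz have "\<forall>\<^sub>F s in F. T \<notin> solvable s"
      by eventually_elim (metis solvable_iff)
    then show ?thesis ..
  qed
qed

lemma eventually_solvable_eq:
  shows "\<forall>\<^sub>F s in at_right t. solvable s = solvable_right t"
    and "\<forall>\<^sub>F s in at_left t. solvable s = solvable_left t"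
proof -
  have "\<forall>\<^sub>F s in at_right t. \<forall>T. T \<in> solvable s \<longleftrightarrow> T \<in> solvable_right t"
    unfolding solvable_right_def mem_Collect_eq
    by (intro eventually_all_finite eventually_eq_eventually eventually_solvable_or_not) auto
  then show "\<forall>\<^sub>F s in at_right t. solvable s = solvable_right t"
    by (rule eventually_mono) blast
  have "\<forall>\<^sub>F s in at_left t. \<forall>T. T \<in> solvable s \<longleftrightarrow> T \<in> solvable_left t"
    unfolding solvable_left_def mem_Collect_eq
    by (intro eventually_all_finite eventually_eq_eventually eventually_solvable_or_not) auto
  then show "\<forall>\<^sub>F s in at_left t. solvable s = solvable_left t"
    by (rule eventually_mono) blast
qed

lemma solvable_right_iff:
  assumes "\<forall>\<^sub>F s in at_right t. T \<in> solvable s \<longleftrightarrow> P"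
  shows "T \<in> solvable_right t \<longleftrightarrow> P"
  using eventually_happens[OF eventually_conj[OF assms eventually_solvable_eq(1)[of t]]] by auto

lemma solvable_left_iff:
  assumes "\<forall>\<^sub>F s in at_left t. T \<in> solvable s \<longleftrightarrow> P"
  shows "T \<in> solvable_left t \<longleftrightarrow> P"
  using eventually_happens[OF eventually_conj[OF assms eventually_solvable_eq(2)[of t]]] by auto

text \<open>At the simple root \<open>t\<close> the determinant changes sign, while the Cramer
  numerators tend to a nonzero multiple of the positive kernel vector and so share one constant
  sign. Hence the solution is positive on one side of \<open>t\<close> and negative on the
  other.\<close>

lemma crossing_aligned:
  assumes t: "t \<ge> 0" and T: "T \<in> aligned t"
  shows "T \<in> solvable_right t \<longleftrightarrow> T \<notin> solvable_left t"
proof -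
  obtain v where v: "\<And>i. v $ i \<ge> 0" "v \<noteq> 0" "pencil A T t *v v = 0"
    using T by (auto simp: aligned_def)
  have pos: "v $ i > 0" for i using kernel_pos[OF t v] .
  have "order t (det_poly A T) = 1" using kernel_simple[OF t v] .
  then obtain E where E: "det_poly A T = [:- t, 1:] * E" "\<not> [:- t, 1:] dvd E"
    using order_decomp[OF det_poly_nonzero, of A T t] by auto
  then have Et: "poly E t \<noteq> 0" by (simp add: poly_eq_0_iff_dvd)
  have D: "poly (det_poly A T) s = (s - t) * poly E s" for s
    by (simp add: E(1) algebra_simps)
  define q where "q s = (\<chi> i. poly (cramer_poly A y T i) s)" for s
  \<comment> \<open>This is Cramer's rule cleared of its denominator. It holds off \<open>t\<close>
    first and is carried to \<open>t\<close> by \<open>cont\<close>.\<close>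
  have solve: "\<forall>\<^sub>F s in at t. pencil A T s *v q s = poly (det_poly A T) s *\<^sub>R y"
    using eventually_det_nonzero_at[of T t]
  proof eventually_elim
    case (elim s)
    have "q s = poly (det_poly A T) s *\<^sub>R (\<chi> i. poly (cramer_poly A y T i) s / poly (det_poly A T) s)"
      using elim by (simp add: vec_eq_iff q_def poly_det_poly)
    then show ?case
      using pencil_solve[OF elim, THEN iffD2, OF refl] by (simp add: matrix_vector_mult_scaleR)
  qed
  \<comment> \<open>The limit at \<open>t\<close> is taken for the Cramer vector \<open>q\<close>,
    and again after a factor \<open>s - t\<close> has been divided out.\<close>
  have cont: "pencil A T t *v r t = poly p t *\<^sub>R y"
    if r: "\<And>i. \<exists>p. \<forall>s. r s $ i = poly p s"
      and ev: "\<forall>\<^sub>F s in at t. pencil A T s *v r s = poly p s *\<^sub>R y" for r :: "real \<Rightarrow> real ^ 'n" and p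
  proof -
    have rl: "((\<lambda>s. r s) \<longlongrightarrow> r t) (at t)"
    proof (rule vec_tendstoI)
      fix i
      obtain p where "\<And>s. r s $ i = poly p s" using r by blast
      then show "((\<lambda>s. r s $ i) \<longlongrightarrow> r t $ i) (at t)"
        by (simp add: isCont_def[symmetric])
    qed
    have "((\<lambda>s. pencil A T s *v r s) \<longlongrightarrow> pencil A T t *v r t) (at t)"
    proof (rule vec_tendstoI)
      fix i
      show "((\<lambda>s. (pencil A T s *v r s) $ i) \<longlongrightarrow> (pencil A T t *v r t) $ i) (at t)"
        unfolding pencil_mult_nth
        by (intro tendsto_intros tendsto_vec_nth rl
            bounded_linear.tendsto[OF matrix_vector_mul_bounded_linear])
    qed
    moreover have "((\<lambda>s. pencil A T s *v r s) \<longlongrightarrow> poly p t *\<^sub>R y) (at t)"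
      by (rule Lim_transform_eventually[OF _ eventually_mono[OF ev sym]])
         (auto intro!: tendsto_intros simp: isCont_def[symmetric])
    ultimately show ?thesis by (rule tendsto_unique[OF trivial_limit_at])
  qed
  have "pencil A T t *v q t = poly (det_poly A T) t *\<^sub>R y"
    by (rule cont[OF _ solve]) (auto simp: q_def)
  then have "pencil A T t *v q t = 0" by (simp add: D)
  then obtain c where c: "q t = c *\<^sub>R v" using kernel_unique[OF t v] by metis
  \<comment> \<open>If the residue of the solution curve vanished, the simple zero of the determinant
    could be cancelled and \<open>y\<close> would lie in the range of the singular matrix.\<close>
  have c0: "c \<noteq> 0"
  proof
    assume "c = 0"
    then have "\<forall>i. \<exists>r. cramer_poly A y T i = [:- t, 1:] * r"
      using c by (simp add: vec_eq_iff q_def poly_eq_0_iff_dvd dvd_def)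
    then obtain r where r: "\<And>i. cramer_poly A y T i = [:- t, 1:] * r i" by metis
    define \<rho> where "\<rho> s = (\<chi> i. poly (r i) s)" for s
    have q\<rho>: "q s = (s - t) *\<^sub>R \<rho> s" for s
      by (simp add: q_def \<rho>_def vec_eq_iff r algebra_simps)
    have "\<forall>\<^sub>F s in at t. pencil A T s *v \<rho> s = poly E s *\<^sub>R y"
      using solve eventually_neq_at_within[of t t UNIV]
    proof eventually_elim
      case (elim s)
      then have "(s - t) *\<^sub>R (pencil A T s *v \<rho> s) = (s - t) *\<^sub>R (poly E s *\<^sub>R y)"
        by (simp add: q\<rho> D matrix_vector_mult_scaleR)
      then show ?case
        using elim(2) by (metis eq_iff_diff_eq_0 scaleR_cancel_left)
    qed
    then have "pencil A T t *v \<rho> t = poly E t *\<^sub>R y"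
      by (rule cont[rotated]) (auto simp: \<rho>_def)
    then have "pencil A T t *v ((1 / poly E t) *\<^sub>R \<rho> t) = y"
      using Et by (simp add: matrix_vector_mult_scaleR)
    then have "det (pencil A T t) \<noteq> 0" by (rule det_nonzero)
    then show False using D[of t] by (simp add: poly_det_poly)
  qed
  \<comment> \<open>The sign of \<open>w\<close> decides on which side of \<open>t\<close> the
    pattern is solvable: every numerator times \<open>E\<close> has this sign near
    \<open>t\<close>.\<close>
  define w where "w = c * poly E t"
  have w0: "w \<noteq> 0" using c0 Et by (simp add: w_def)
  have "\<forall>\<^sub>F s in at t. poly (cramer_poly A y T i) s * poly E s * w > 0" for i
  proof (rule order_tendstoD(1))
    have "poly (cramer_poly A y T i) t = c * v $ i" using c by (simp add: vec_eq_iff q_def)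
    then have "poly (cramer_poly A y T i) t * poly E t * w = v $ i * (w * w)"
      by (simp add: w_def)
    then show "((\<lambda>s. poly (cramer_poly A y T i) s * poly E s * w) \<longlongrightarrow> v $ i * (w * w)) (at t)"
      using isContD[OF poly_isCont[of t "cramer_poly A y T i * E * [:w:]"]]
      by (simp only: poly_mult poly_pCons poly_0 mult_zero_right add_0_right)
    show "v $ i * (w * w) > 0" using pos[of i] w0 by (simp add: zero_less_mult_iff) linarith
  qed
  then have "\<forall>\<^sub>F s in at t. \<forall>i. poly (cramer_poly A y T i) s * poly E s * w > 0"
    by (intro eventually_all_finite)
  then have ev: "\<forall>\<^sub>F s in at t. T \<in> solvable s \<longleftrightarrow> (s - t) * w > 0"
    using eventually_det_nonzero_at[of T t]
  proof eventually_elim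
    case (elim s)
    have "poly (cramer_poly A y T i * det_poly A T) s > 0 \<longleftrightarrow> (s - t) * w > 0" for i
    proof -
      define X where "X = poly (cramer_poly A y T i) s * poly E s"
      have "X * w > 0" using elim(1) by (simp add: X_def)
      moreover have "poly (cramer_poly A y T i * det_poly A T) s = (s - t) * X"
        by (simp add: D X_def)
      ultimately show ?thesis by (auto simp: zero_less_mult_iff)
    qed
    then show ?case using elim(2) by (simp add: solvable_iff)
  qed
  have "\<forall>\<^sub>F s in at_right t. T \<in> solvable s \<longleftrightarrow> w > 0"
    using filter_leD[OF at_one_sided_le_at[OF disjI2[OF refl]] ev] eventually_at_right_less[of t]
    by eventually_elim (simp add: zero_less_mult_iff)
  moreover have "\<forall>\<^sub>F s in at_left t. s < t" by (auto simp: eventually_at_filter)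
  with filter_leD[OF at_one_sided_le_at[OF disjI1[OF refl]] ev]
  have "\<forall>\<^sub>F s in at_left t. T \<in> solvable s \<longleftrightarrow> w < 0"
    by eventually_elim (simp add: zero_less_mult_iff)
  ultimately show ?thesis
    using solvable_right_iff solvable_left_iff w0 by (metis linorder_neqE_linordered_idom less_asym)
qed

text \<open>By continuity the coordinates other than \<open>i\<close> stay positive and the
  determinant keeps its sign near \<open>t\<close>, so numerator \<open>i\<close> alone decides
  solvability.\<close>

lemma eventually_solvable_iff_cramer:
  assumes x: "pencil A T t *v x = y" "\<forall>j. j \<noteq> i \<longrightarrow> x $ j > 0"
  shows "\<forall>\<^sub>F s in at t. T \<in> solvable s \<longleftrightarrow> poly (cramer_poly A y T i) s * det (pencil A T t) > 0"
proof -
  have d: "det (pencil A T t) \<noteq> 0" by (rule det_nonzero[OF x(1)])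
  have pc: "((\<lambda>s. poly p s) \<longlongrightarrow> poly p t) (at t)" for p :: "real poly"
    by (rule isContD[OF poly_isCont])
  have "\<forall>\<^sub>F s in at t. j \<noteq> i \<longrightarrow> poly (cramer_poly A y T j * det_poly A T) s > 0" for j
  proof (cases "j = i")
    case False
    have "x $ j = poly (cramer_poly A y T j) t / poly (det_poly A T) t"
      using pencil_solve[OF d, THEN iffD1, OF x(1)] by (simp add: vec_eq_iff)
    then have "poly (cramer_poly A y T j * det_poly A T) t > 0"
      using x(2) False by (auto simp: zero_less_divide_iff zero_less_mult_iff)
    then have "\<forall>\<^sub>F s in at t. poly (cramer_poly A y T j * det_poly A T) s > 0"
      by (rule order_tendstoD(1)[OF pc])
    then show ?thesis by (rule eventually_mono) simp
  qed simp
  then have 1: "\<forall>\<^sub>F s in at t. \<forall>j. j \<noteq> i \<longrightarrow> poly (cramer_poly A y T j * det_poly A T) s > 0"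
    by (rule eventually_all_finite)
  have "\<forall>\<^sub>F s in at t. poly (det_poly A T * [:det (pencil A T t):]) s > 0"
    by (rule order_tendstoD(1)[OF pc]) (use d in \<open>auto simp: poly_det_poly zero_less_mult_iff\<close>)
  with 1 eventually_det_nonzero_at[of T t] show ?thesis
  proof eventually_elim
    case (elim s)
    have "T \<in> solvable s \<longleftrightarrow> poly (cramer_poly A y T i * det_poly A T) s > 0"
      using elim(1,2) by (metis solvable_iff)
    then show ?case using elim(3) by (auto simp: poly_det_poly zero_less_mult_iff)
  qed
qed

lemma solvable_persists:
  assumes "T \<in> solvable t"
  shows "T \<in> solvable_right t" and "T \<in> solvable_left t"
proof -
  obtain x where x: "pencil A T t *v x = y" "\<forall>j. x $ j > 0"
    using assms by (auto simp: solvable_def)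
  \<comment> \<open>All coordinates are positive, so any index can serve as the distinguished
    one.\<close>
  obtain i :: 'n where True by blast
  have d: "det (pencil A T t) \<noteq> 0" by (rule det_nonzero[OF x(1)])
  have "x $ i = poly (cramer_poly A y T i) t / det (pencil A T t)"
    using pencil_solve[OF d, THEN iffD1, OF x(1)] by (simp add: vec_eq_iff poly_det_poly)
  then have "poly (cramer_poly A y T i * [:det (pencil A T t):]) t > 0"
    using x(2)[rule_format, of i] d by (auto simp: zero_less_divide_iff zero_less_mult_iff)
  then have "\<forall>\<^sub>F s in at t. poly (cramer_poly A y T i * [:det (pencil A T t):]) s > 0"
    by (rule order_tendstoD(1)[OF isContD[OF poly_isCont]])
  moreover have "\<forall>\<^sub>F s in at t. T \<in> solvable s \<longleftrightarrow>
      poly (cramer_poly A y T i) s * det (pencil A T t) > 0"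
    using x by (intro eventually_solvable_iff_cramer) auto
  ultimately have "\<forall>\<^sub>F s in at t. T \<in> solvable s \<longleftrightarrow> True"
    by eventually_elim (simp add: mult.commute)
  then show "T \<in> solvable_right t" "T \<in> solvable_left t"
    using solvable_right_iff[of T True t] solvable_left_iff[of T True t]
      filter_leD[OF at_one_sided_le_at] by blast+
qed

text \<open>The determinant has the same sign on both sides of \<open>t\<close>, so it drops out of
  the comparison. What remains is a condition on \<open>cramer_poly A y T i\<close> alone, which by
  \<open>cramer_poly_flip\<close> is shared by \<open>flip i T\<close>.\<close>

lemma crossing_iff_cramer_sign_change:
  assumes x: "pencil A T t *v x = y" "\<forall>j. j \<noteq> i \<longrightarrow> x $ j > 0"
  shows "(T \<in> solvable_right t \<longleftrightarrow> T \<in> solvable_left t) \<longleftrightarrow>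
    ((\<forall>\<^sub>F s in at_right t. poly (cramer_poly A y T i) s > 0) \<longleftrightarrow>
     (\<forall>\<^sub>F s in at_left t. poly (cramer_poly A y T i) s > 0))"
proof -
  let ?p = "cramer_poly A y T i" and ?d = "det (pencil A T t)"
  have d: "?d \<noteq> 0" by (rule det_nonzero[OF x(1)])
  have side: "\<forall>\<^sub>F s in F. T \<in> solvable s \<longleftrightarrow> ((\<forall>\<^sub>F s in F. poly ?p s > 0) \<longleftrightarrow> ?d > 0)"
    if F: "F = at_left t \<or> F = at_right t" for F
  proof -
    have "\<forall>\<^sub>F s in F. poly ?p s \<noteq> 0"
      using filter_leD[OF at_one_sided_le_at[OF F] eventually_poly_nonzero[OF cramer_poly_nonzero]]
        y_nonzero by blast
    moreover have "\<forall>\<^sub>F s in F. poly ?p s > 0 \<longleftrightarrow> (\<forall>\<^sub>F s in F. poly ?p s > 0)"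
      by (intro eventually_eq_eventually poly_eventually_pos_or_not[OF F])
    moreover note filter_leD[OF at_one_sided_le_at[OF F] eventually_solvable_iff_cramer[OF x]]
    ultimately show ?thesis
      by eventually_elim (use d in \<open>auto simp: zero_less_mult_iff\<close>)
  qed
  show ?thesis
    using solvable_right_iff[OF side] solvable_left_iff[OF side] by blast
qed

text \<open>Without a nonnegative solution at \<open>t\<close>, compactness would make
  \<open>T\<close> unsolvable on both sides; with a strictly positive one, \<open>T\<close> would be
  solvable on both. This leaves a solution on the boundary, where \<open>one_zero\<close> allows a
  single zero coordinate.\<close>

lemma crossing_nonaligned:
  assumes T: "T \<notin> aligned t" and cross: "T \<in> solvable_right t \<longleftrightarrow> T \<notin> solvable_left t"
  obtains x i where "pencil A T t *v x = y" "x $ i = 0" "\<forall>j. j \<noteq> i \<longrightarrow> x $ j > 0"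
proof -
  have "\<exists>x. (\<forall>i. x $ i \<ge> 0) \<and> pencil A T t *v x = y"
  proof (rule ccontr)
    assume no: "\<nexists>x. (\<forall>i. x $ i \<ge> 0) \<and> pencil A T t *v x = y"
    have "\<forall>\<^sub>F s in nhds t. \<forall>x. (\<forall>i. x $ i \<ge> 0) \<longrightarrow> pencil A T s *v x \<noteq> y"
      using no T by (intro eventually_no_nonneg_solution) (auto simp: aligned_def)
    then have "\<forall>\<^sub>F s in nhds t. T \<notin> solvable s"
    proof eventually_elim
      case (elim s)
      then show ?case unfolding solvable_def mem_Collect_eq by (metis less_imp_le)
    qed
    then have "\<forall>\<^sub>F s in at t. T \<in> solvable s \<longleftrightarrow> False"
      by (simp add: eventually_nhds_conv_at)
    then show False
      using solvable_right_iff[of T False t] solvable_left_iff[of T False t]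
        filter_leD[OF at_one_sided_le_at] cross by blast
  qed
  then obtain x where x: "\<And>i. x $ i \<ge> 0" "pencil A T t *v x = y" by blast
  obtain i where i: "x $ i = 0"
  proof -
    have "T \<notin> solvable t" using cross solvable_persists by blast
    then have "\<exists>i. \<not> x $ i > 0" using x(2) by (auto simp: solvable_def)
    then show thesis using that x(1) by (metis order_le_less)
  qed
  have "\<forall>j. j \<noteq> i \<longrightarrow> x $ j > 0"
    using one_zero[OF x(2) i] x(1) by (metis order_le_less)
  then show thesis using that x(2) i by blast
qed

text \<open>Modulo 2 the two one-sided counts add up to the number of patterns in \<open>C\<close>,
  those that change. All aligned patterns change, and the remaining ones are paired by flipping the
  zero coordinate of their solution.\<close>

lemma parity_crossing:
  assumes t: "t \<ge> 0"
  shows "even (card (solvable_right t) + card (solvable_left t) + card (aligned t))"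
proof -
  let ?R = "solvable_right t" and ?L = "solvable_left t"
  define C where "C = (?R - ?L) \<union> (?L - ?R)"
  \<comment> \<open>The description is unambiguous once a solution with a zero coordinate exists:
    the pencil is then nonsingular, so the solution is unique, and \<open>one_zero\<close> makes the
    index unique.\<close>
  define h where "h T = flip (THE i. \<exists>x. pencil A T t *v x = y \<and> x $ i = 0) T" for T
  have h: "h T = flip i T" if "pencil A T t *v x = y" "x $ i = 0" for T x i
  proof -
    have "(THE i. \<exists>x. pencil A T t *v x = y \<and> x $ i = 0) = i"
    proof (rule the_equality)
      fix j assume "\<exists>x. pencil A T t *v x = y \<and> x $ j = 0"
      then have "x $ j = 0" using that pencil_solve[OF det_nonzero[OF that(1)]] by metis
      then show "j = i" using one_zero that by blast
    qed (use that in blast)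
    then show ?thesis by (simp add: h_def)
  qed
  have "even (card (C - aligned t))"
  proof (rule even_card_fixpoint_free_involution[where h = h])
    fix T assume "T \<in> C - aligned t"
    then have T: "T \<notin> aligned t" "T \<in> ?R \<longleftrightarrow> T \<notin> ?L" by (auto simp: C_def)
    obtain x i where x: "pencil A T t *v x = y" "x $ i = 0" "\<forall>j. j \<noteq> i \<longrightarrow> x $ j > 0"
      using crossing_nonaligned[OF T] by blast
    \<comment> \<open>As \<open>x $ i = 0\<close>, the same \<open>x\<close> solves the flipped
      system, so a second application of \<open>h\<close> flips the same index back.\<close>
    have x': "pencil A (flip i T) t *v x = y" using x by (simp add: pencil_flip_mult)
    have hT: "h T = flip i T" using h x by blast
    show "h T \<noteq> T" by (simp add: hT flip_neq)
    show "h (h T) = T" using h[OF x' x(2)] by (simp add: hT)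
    have "h T \<in> C"
      using crossing_iff_cramer_sign_change[OF x(1,3)] crossing_iff_cramer_sign_change[OF x' x(3)] T(2)
      by (auto simp: C_def hT cramer_poly_flip)
    moreover have "h T \<notin> aligned t"
      using det_nonzero[OF x'] by (auto simp: hT aligned_def det_nonzero_iff_kernel)
    ultimately show "h T \<in> C - aligned t" by blast
  qed
  moreover have "aligned t \<subseteq> C" using crossing_aligned[OF t] by (auto simp: C_def)
  then have "card (C - aligned t) + card (aligned t) = card C"
    by (metis card_Diff_subset card_mono finite le_add_diff_inverse2)
  moreover have "card C = card (?R - ?L) + card (?L - ?R)"
    unfolding C_def by (rule card_Un_disjoint) auto
  moreover have "card ?R = card (?R - ?L) + card (?R \<inter> ?L)" "card ?L = card (?L - ?R) + card (?R \<inter> ?L)"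
    by (metis card_Diff_subset_Int finite Int_commute card_mono inf_le1 inf_le2 le_add_diff_inverse2)+
  ultimately show ?thesis by (metis (no_types, lifting) even_add)
qed

text \<open>For large \<open>t\<close> each solution coordinate has the sign of
  \<open>sign_at T i * y $ i\<close>, so a positive solution forces \<open>T\<close> to be the sign
  pattern of \<open>y\<close>.\<close>

lemma eventually_card_solvable_at_top: "\<forall>\<^sub>F t in at_top. card (solvable t) = 1"
  using eventually_pencil_large[of A y] eventually_det_pencil_nonzero[of A]
proof eventually_elim
  case (elim t)
  define T\<^sub>0 where "T\<^sub>0 = {i. y $ i < 0}"
  have "T \<in> solvable t \<longleftrightarrow> T = T\<^sub>0" for T
  proof
    assume "T \<in> solvable t"
    then obtain x where x: "\<forall>i. x $ i > 0" "pencil A T t *v x = y"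
      by (auto simp: solvable_def)
    have "sign_at T i * x $ i * y $ i > 0" for i using elim(1) x(2) y_nonzero by blast
    then have "sign_at T i * y $ i > 0" for i
      using x(1) by (metis mult.assoc mult.commute zero_less_mult_pos)
    then have "i \<in> T \<longleftrightarrow> y $ i < 0" for i
      by (metis (full_types) sign_at_def mult_1 mult_minus1 neg_0_less_iff_less less_asym)
    then show "T = T\<^sub>0" by (auto simp: T\<^sub>0_def)
  next
    assume T: "T = T\<^sub>0"
    have d: "det (pencil A T t) \<noteq> 0" using elim(2) by blast
    obtain x where x: "pencil A T t *v x = y" using pencil_solve[OF d] by blast
    have "x $ i > 0" for i
    proof -
      have "sign_at T i * x $ i * y $ i > 0" using elim(1) x y_nonzero by blast
      moreover have "sign_at T i * y $ i > 0"
        using y_nonzero[of i] by (auto simp: T T\<^sub>0_def sign_at_def)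
      ultimately show ?thesis
        by (metis mult.assoc mult.commute zero_less_mult_pos)
    qed
    then show "T \<in> solvable t" using x by (auto simp: solvable_def)
  qed
  then have "solvable t = {T\<^sub>0}" by blast
  then show ?case by simp
qed

section \<open>Reflection of the parameter and the count near zero\<close>

lemma pencil_Compl: "pencil A (- T) t = pencil A T (- t)"
  by (auto simp: pencil_def sign_at_def vec_eq_iff)

text \<open>Negating both the sign pattern and the parameter leaves the pencil unchanged, so the
  behaviour of \<open>- T\<close> just right of 0 mirrors that of \<open>T\<close> just left of
  0.\<close>

lemma solvable_right_0_Compl: "- T \<in> solvable_right 0 \<longleftrightarrow> T \<in> solvable_left 0"
proof -
  have "- T \<in> solvable s \<longleftrightarrow> T \<in> solvable (- s)" for s
    by (simp add: solvable_def pencil_Compl)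
  then show ?thesis
    by (simp add: solvable_right_def solvable_left_def at_left_minus[of 0] eventually_filtermap)
qed

lemma pencil_0_mult: "pencil A T 0 *v x = - (A *v x)"
  by (simp add: vec_eq_iff pencil_mult_nth)

lemma aligned_0: "aligned 0 = {} \<or> aligned 0 = UNIV"
  by (auto simp: aligned_def pencil_0_mult)

text \<open>With no aligned pattern at 0, the count just right of 0 equals the one at 0, where the
  system does not depend on \<open>T\<close>. Otherwise every pattern crosses at 0, and reflection
  selects one from each complementary pair. That gives half of \<open>2 ^ CARD('n)\<close>, which is
  even only from dimension two on.\<close>

lemma even_card_solvable_right_0:
  assumes "aligned 0 = {} \<or> CARD('n) \<ge> 2"
  shows "even (card (solvable_right 0))"
proof (cases "aligned 0 = {}")
  case True
  show ?thesis
  proof (cases "\<exists>x. (\<forall>i. x $ i > 0) \<and> - (A *v x) = y")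
    case True
    then have "T \<in> solvable 0" for T by (simp add: solvable_def pencil_0_mult)
    then have "solvable_right 0 = UNIV" using solvable_persists by blast
    then show ?thesis by (simp add: card_UNIV_set)
  next
    case False
    \<comment> \<open>Preimages with a zero coordinate are excluded, so absence of a positive
      solution means absence of a nonnegative one.\<close>
    have "x $ i \<noteq> 0" if "- (A *v x) = y" for x i
      using preimage_nonzero[of "- x" i] that by (simp add: linear_neg)
    then have "\<not> (\<forall>i. x $ i \<ge> 0)" if "- (A *v x) = y" for x
      using False that by (metis order_le_less)
    then have "T \<notin> solvable_right 0" for T
    proof -
      have "T \<notin> aligned 0" using True by simp
      then have "pencil A T 0 *v x \<noteq> 0" if "\<forall>i. x $ i \<ge> 0" "norm x = 1" for x
        using that unfolding aligned_def by force
      then have "\<forall>\<^sub>F s in nhds 0. \<forall>x. (\<forall>i. x $ i \<ge> 0) \<longrightarrow> pencil A T s *v x \<noteq> y"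
        using \<open>\<And>x. - (A *v x) = y \<Longrightarrow> \<not> (\<forall>i. x $ i \<ge> 0)\<close>
        by (intro eventually_no_nonneg_solution) (auto simp: pencil_0_mult)
      then have "\<forall>\<^sub>F s in nhds 0. T \<in> solvable s \<longleftrightarrow> False"
      proof eventually_elim
        case (elim s)
        then show ?case unfolding solvable_def mem_Collect_eq by (metis less_imp_le)
      qed
      then have "\<forall>\<^sub>F s in at_right 0. T \<in> solvable s \<longleftrightarrow> False"
        by (simp add: eventually_nhds_conv_at eventually_at_split)
      then show ?thesis using solvable_right_iff by blast
    qed
    then have "solvable_right 0 = {}" by blast
    then show ?thesis by simp
  qed
next
  case False
  then have U: "aligned 0 = UNIV" and n: "CARD('n) \<ge> 2" using aligned_0 assms by auto
  have "- T \<in> solvable_right 0 \<longleftrightarrow> T \<notin> solvable_right 0" for T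
    using crossing_aligned[of 0 T] by (simp add: U solvable_right_0_Compl)
  then have "uminus ` solvable_right 0 = - solvable_right 0"
    by (auto simp: image_iff)
  then have "card (- solvable_right 0) = card (solvable_right 0)"
    by (metis card_image inj_on_def double_complement)
  moreover have "card (solvable_right 0) + card (- solvable_right 0) = card (UNIV :: 'n set set)"
    by (metis Compl_disjoint Compl_partition card_Un_disjoint finite)
  ultimately have "2 * card (solvable_right 0) = 2 ^ CARD('n)"
    by (simp add: card_UNIV_set)
  moreover have "CARD('n) = Suc (Suc (CARD('n) - 2))" using n by simp
  then obtain k where "CARD('n) = Suc (Suc k)" by blast
  ultimately show ?thesis by simp
qed

text \<open>Since \<open>solvable\<close> is constant on a short interval on each side of
  \<open>t\<close>, \<open>solvable_right\<close> takes the same value inside that interval. It is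
  thus a right-continuous version of \<open>solvable\<close>, with the same one-sided
  limits.\<close>

lemma eventually_solvable_right_eq:
  shows "\<forall>\<^sub>F s in at_right t. solvable_right s = solvable_right t"
    and "\<forall>\<^sub>F s in at_left t. solvable_right s = solvable_left t"
proof -
  have *: "solvable_right s = X" if X: "\<And>u. a < u \<Longrightarrow> u < b \<Longrightarrow> solvable u = X" and s: "a < s" "s < b"
    for a b s X
  proof -
    have "\<forall>\<^sub>F u in at_right s. T \<in> solvable u \<longleftrightarrow> T \<in> X" for T
      unfolding eventually_at_right_field using X s by (intro exI[of _ b]) auto
    then show ?thesis using solvable_right_iff by blast
  qed
  obtain b where b: "b > t" "\<And>u. t < u \<Longrightarrow> u < b \<Longrightarrow> solvable u = solvable_right t"
    using eventually_solvable_eq(1)[of t] unfolding eventually_at_right_field by blast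
  show "\<forall>\<^sub>F s in at_right t. solvable_right s = solvable_right t"
    unfolding eventually_at_right_field using *[OF b(2)] b(1) by blast
  obtain a where a: "a < t" "\<And>u. a < u \<Longrightarrow> u < t \<Longrightarrow> solvable u = solvable_left t"
    using eventually_solvable_eq(2)[of t] unfolding eventually_at_left_field by blast
  show "\<forall>\<^sub>F s in at_left t. solvable_right s = solvable_left t"
    unfolding eventually_at_left_field using *[OF a(2)] a(1) by blast
qed

section \<open>The parity count along the positive half line\<close>

lemma finite_aligned: "finite {t. aligned t \<noteq> {}}"
proof (rule finite_subset)
  show "{t. aligned t \<noteq> {}} \<subseteq> (\<Union>T. {t. poly (det_poly A T) t = 0})"
    unfolding aligned_def poly_det_poly using det_nonzero_iff_kernel by fastforce
  show "finite (\<Union>T. {t. poly (det_poly A T) t = 0})"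
    by (intro finite_UN_I finite poly_roots_finite det_poly_nonzero)
qed

text \<open>The parity \<open>h\<close> of the current count plus the aligned patterns still ahead
  is locally constant for positive parameters, hence constant by connectedness. It is odd far out,
  and right-continuity at 0, where the count is even, moves the oddness to the sum.\<close>

theorem odd_sum_card_aligned:
  assumes "aligned 0 = {} \<or> CARD('n) \<ge> 2"
  shows "odd (\<Sum>t | t > 0 \<and> aligned t \<noteq> {}. card (aligned t))"
proof -
  define V where "V = {t. t > 0 \<and> aligned t \<noteq> {}}"
  have fV: "finite V" unfolding V_def by (rule finite_subset[OF _ finite_aligned]) auto
  \<comment> \<open>The strict inequality matches \<open>solvable_right\<close>: both describe the
    situation just after \<open>t\<close>.\<close>
  define W where "W t = (\<Sum>s | s \<in> V \<and> s > t. card (aligned s))" for t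
  define h where "h t \<longleftrightarrow> odd (card (solvable_right t) + W t)" for t
  have noV: "\<forall>\<^sub>F s in at t. s \<notin> V" for t
    using islimpt_finite[OF fV, of t] by (simp add: islimpt_iff_eventually)
  have W_right: "\<forall>\<^sub>F s in at_right t. W s = W t" for t
  proof -
    obtain b where b: "b > t" "\<And>s. t < s \<Longrightarrow> s < b \<Longrightarrow> s \<notin> V"
      using noV[of t] unfolding eventually_at_split eventually_at_right_field by blast
    have "W s = W t" if s: "t < s" "s < b" for s
    proof -
      have "{u. u \<in> V \<and> u > s} = {u. u \<in> V \<and> u > t}" using b s by force
      then show ?thesis by (simp add: W_def)
    qed
    then show ?thesis unfolding eventually_at_right_field using b(1) by blast
  qed
  \<comment> \<open>Going left past \<open>t\<close>, \<open>W\<close> gains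
    \<open>card (aligned t)\<close>, and by \<open>parity_crossing\<close> this compensates the
    change from \<open>solvable_right t\<close> to \<open>solvable_left t\<close>.\<close>
  have W_left: "\<forall>\<^sub>F s in at_left t. W s = W t + card (aligned t)" if t: "t > 0" for t
  proof -
    obtain a where a: "a < t" "\<And>s. a < s \<Longrightarrow> s < t \<Longrightarrow> s \<notin> V"
      using noV[of t] unfolding eventually_at_split eventually_at_left_field by blast
    have "W s = W t + card (aligned t)" if s: "a < s" "s < t" for s
    proof -
      have ge: "u \<ge> t" if "u \<in> V" "u > s" for u
        using a(2)[of u] s that by force
      show ?thesis
      proof (cases "t \<in> V")
        case True
        then have "{u. u \<in> V \<and> u > s} = insert t {u. u \<in> V \<and> u > t}"
          using ge s by (auto simp: order_le_less)
        then show ?thesis using fV by (simp add: W_def)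
      next
        case False
        then have "{u. u \<in> V \<and> u > s} = {u. u \<in> V \<and> u > t}"
          using ge s by (auto simp: order_le_less)
        then show ?thesis using False t by (simp add: W_def V_def)
      qed
    qed
    then show ?thesis unfolding eventually_at_left_field using a(1) by blast
  qed
  have h_right: "\<forall>\<^sub>F s in at_right t. h s = h t" for t
    using eventually_solvable_right_eq(1)[of t] W_right[of t]
    by eventually_elim (simp add: h_def)
  have h_left: "\<forall>\<^sub>F s in at_left t. h s = h t" if "t > 0" for t
    using eventually_solvable_right_eq(2)[of t] W_left[OF that]
  proof eventually_elim
    case (elim s)
    then show ?case using parity_crossing[of t] that by (auto simp: h_def)
  qed
  have const: "h s = h t" if "s > 0" "t > 0" for s t
  proof (rule connected_local_const[of "{0<..}"])
    show "\<forall>a\<in>{0<..}. \<forall>\<^sub>F b in at a within {0<..}. h a = h b"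
    proof
      fix a :: real assume "a \<in> {0<..}"
      then have "\<forall>\<^sub>F b in at a. h a = h b"
        using h_right[of a] h_left[of a]
        unfolding eventually_at_split by (auto elim: eventually_mono)
      then show "\<forall>\<^sub>F b in at a within {0<..}. h a = h b"
        using at_within_le_at filter_leD by blast
    qed
  qed (use that in auto)
  obtain s where s: "s > 0" "h s"
  proof -
    have fin: "\<forall>\<^sub>F t in at_top. \<forall>v\<in>V. v < t"
      by (intro eventually_ball_finite fV ballI eventually_gt_at_top)
    obtain s where s: "s > 0" "\<forall>v\<in>V. v < s" "\<And>t. t \<ge> s \<Longrightarrow> card (solvable t) = 1"
    proof -
      obtain N where N: "\<And>t. t \<ge> N \<Longrightarrow> (\<forall>v\<in>V. v < t) \<and> card (solvable t) = 1"
        using eventually_conj[OF fin eventually_card_solvable_at_top]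
        unfolding eventually_at_top_linorder by blast
      show thesis by (rule that[of "max N 1"]) (use N in auto)
    qed
    have "\<forall>\<^sub>F t in at_right s. card (solvable_right s) = 1"
      using eventually_solvable_eq(1)[of s] eventually_at_right_less[of s]
      by eventually_elim (metis s(3) less_imp_le)
    then have "card (solvable_right s) = 1" by simp
    moreover have "{u. u \<in> V \<and> s < u} = {}" using s(2) by force
    then have "W s = 0" unfolding W_def by (simp only: sum.empty)
    ultimately have "h s" by (simp add: h_def)
    then show thesis using that s(1) by blast
  qed
  obtain t where "h t = h 0" "t > 0"
    using eventually_happens[OF eventually_conj[OF h_right[of 0] eventually_at_right_less[of 0]]]
    by auto
  then have "h 0" using const[OF s(1)] s(2) by blast
  then have "odd (W 0)" using even_card_solvable_right_0[OF assms] by (simp add: h_def)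
  moreover have "{s. s \<in> V \<and> s > 0} = {t. t > 0 \<and> aligned t \<noteq> {}}" by (auto simp: V_def)
  ultimately show ?thesis by (simp add: W_def)
qed

end

section \<open>Aligned trios\<close>

definition sign_matrix :: "'n set \<Rightarrow> real ^ 'n ^ 'n" where
  "sign_matrix T = (\<chi> i j. if i = j then sign_at T i else 0)"

lemma sign_matrix_mult_nth: "(sign_matrix T ** B) $ i $ j = sign_at T i * B $ i $ j"
  by (simp add: sign_matrix_def matrix_matrix_mult_def if_distrib[of "\<lambda>u. u * _"] cong: if_cong)

lemma sign_matrix_vector_mult_nth: "(sign_matrix T *v x) $ i = sign_at T i * x $ i"
  by (simp add: sign_matrix_def matrix_vector_mult_def if_distrib[of "\<lambda>u. u * _"] cong: if_cong)

lemma sign_matrices_eq_range: "sign_matrices = range sign_matrix"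
proof (intro set_eqI iffI)
  fix S :: "real ^ 'n ^ 'n" assume S: "S \<in> sign_matrices"
  have "S = sign_matrix {i. S $ i $ i = -1}"
    using S by (auto simp: sign_matrices_def sign_matrix_def sign_at_def vec_eq_iff)
  then show "S \<in> range sign_matrix" by blast
qed (auto simp: sign_matrices_def sign_matrix_def sign_at_def split: if_splits)

lemma inj_sign_matrix: "inj sign_matrix"
proof (rule injI, rule set_eqI)
  fix T U :: "'n::finite set" and i assume "sign_matrix T = sign_matrix U"
  then have "sign_matrix T $ i $ i = sign_matrix U $ i $ i" by simp
  then show "i \<in> T \<longleftrightarrow> i \<in> U" by (auto simp: sign_matrix_def sign_at_def split: if_splits)
qed

lemma pencil_kernel_iff:
  "pencil A T t *v v = 0 \<longleftrightarrow> A *v v = t *\<^sub>R (sign_matrix T *v v)"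
  by (auto simp: vec_eq_iff pencil_mult_nth sign_matrix_vector_mult_nth algebra_simps)

lemma sign_matrix_eigenvector_iff:
  "(sign_matrix T ** A) *v v = t *\<^sub>R v \<longleftrightarrow> pencil A T t *v v = 0"
proof -
  have "sign_at T i * u = t * w \<longleftrightarrow> t * sign_at T i * w - u = 0" for i u w
    by (cases "i \<in> T") (auto simp: sign_at_def)
  then show ?thesis
    by (simp add: vec_eq_iff pencil_mult_nth sign_matrix_vector_mult_nth
        flip: matrix_vector_mul_assoc)
qed

text \<open>Because \<open>S\<close> is its own inverse, \<open>s I - S A = S (s S - A)\<close>. The
  nonzero constant \<open>det S\<close> leaves root multiplicities unchanged.\<close>

lemma order_charpoly_sign_matrix:
  "order t (charpoly (sign_matrix T ** A)) = order t (det_poly A T)"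
proof -
  have "poly (charpoly (sign_matrix T ** A)) s = poly (smult (det (sign_matrix T)) (det_poly A T)) s" for s
  proof -
    have "poly (charpoly (sign_matrix T ** A)) s = det (sign_matrix T ** pencil A T s)"
      unfolding charpoly_def poly_det
      by (rule arg_cong[where f = det])
         (auto simp: vec_eq_iff mat_def sign_matrix_mult_nth pencil_def sign_at_def)
    then show ?thesis by (simp add: det_mul poly_det_poly)
  qed
  then have "charpoly (sign_matrix T ** A) = smult (det (sign_matrix T)) (det_poly A T)"
    by (metis poly_eq_poly_eq_iff ext)
  moreover have "det (sign_matrix T) \<noteq> 0"
    unfolding det_nonzero_iff_kernel
    by (auto simp: vec_eq_iff sign_matrix_vector_mult_nth sign_at_def split: if_splits)
  ultimately show ?thesis by (simp add: order_smult)
qed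

lemma generic_kernel:
  assumes A: "generic A" and v: "t \<ge> 0" "\<And>j. v $ j \<ge> 0" "v \<noteq> 0" "pencil A T t *v v = 0"
  shows "v $ i > 0" and "order t (det_poly A T) = 1"
proof -
  define u where "u = (1 / norm v) *\<^sub>R v"
  have "pencil A T t *v u = 0" by (simp add: u_def matrix_vector_mult_scaleR v)
  then have "(sign_matrix T ** A) *v u = t *\<^sub>R u" by (simp add: sign_matrix_eigenvector_iff)
  moreover have "norm u = 1" "\<forall>j. u $ j \<ge> 0" using v by (auto simp: u_def)
  ultimately have "simple_eigenvalue (sign_matrix T ** A) t" "\<forall>j. u $ j > 0"
    using A v(1) unfolding generic_def sign_matrices_eq_range by blast+
  then show "v $ i > 0" "order t (det_poly A T) = 1"
    using v(3) by (auto simp: u_def zero_less_divide_iff simple_eigenvalue_def order_charpoly_sign_matrix)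
qed

section \<open>The parity of the LCP-aligned values\<close>

theorem corollary5p7:
  fixes M :: "real ^ 'n ^ 'n"
  assumes "lcp_generic M"
    and "M \<noteq> mat 1"
  shows "finite (lcp_aligned_values M)
    \<and> (\<forall>\<mu> \<in> lcp_aligned_values M. finite (lcp_aligned_pairs M \<mu>))
    \<and> odd (\<Sum>\<mu> \<in> lcp_aligned_values M. lcp_multiplicity M \<mu>)"
proof -
  define N where "N = M + mat 1"
  define A where "A = matrix_inv N ** (M - mat 1)"
  have N: "invertible N" and A: "generic A"
    using assms(1) by (auto simp: lcp_generic_def A_def N_def)
  have NA: "N ** A = M - mat 1"
    using someI_ex[OF N[unfolded invertible_def]]
    by (simp add: A_def matrix_inv_def matrix_mul_assoc)
  obtain y where y: "\<forall>i. y $ i \<noteq> 0"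
      "\<forall>T t x i j. pencil A T t *v x = y \<longrightarrow> x $ i = 0 \<longrightarrow> x $ j = 0 \<longrightarrow> i = j"
      "\<forall>T t x. pencil A T t *v x = y \<longrightarrow> det (pencil A T t) \<noteq> 0"
      "\<forall>x i. A *v x = y \<longrightarrow> x $ i \<noteq> 0"
    using ex_generic_vector[of A] by (elim exE conjE) rule
  interpret generic_pencil A y
    by unfold_locales (fact generic_kernel[OF A] y[rule_format])+
  \<comment> \<open>The matrix \<open>N\<close> is invertible, so it can be cancelled from both
    sides.\<close>
  have kernel: "(M - mat 1) *v v = \<mu> *\<^sub>R ((M + mat 1) *v (sign_matrix T *v v))
      \<longleftrightarrow> pencil A T \<mu> *v v = 0" for \<mu> T v
  proof -
    have "(M - mat 1) *v v = N *v (A *v v)"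
      by (simp add: matrix_vector_mul_assoc NA)
    moreover have "\<mu> *\<^sub>R (N *v (sign_matrix T *v v)) = N *v (\<mu> *\<^sub>R (sign_matrix T *v v))"
      by (simp add: matrix_vector_mult_scaleR)
    moreover have "inj ((*v) N)" by (rule inj_matrix_vector_mult[OF N])
    ultimately show ?thesis
      unfolding pencil_kernel_iff N_def[symmetric] by (metis injD)
  qed
  define unit where "unit \<mu> T v \<longleftrightarrow> (\<forall>i. v $ i \<ge> 0) \<and> norm v = 1 \<and> pencil A T \<mu> *v v = 0" for \<mu> T v
  have trio: "lcp_aligned_trio M \<mu> S v \<longleftrightarrow> \<mu> \<ge> 0 \<and> (\<exists>T. S = sign_matrix T \<and> unit \<mu> T v)" for \<mu> S v
    unfolding lcp_aligned_trio_def sign_matrices_eq_range unit_def using kernel by blast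
  have aligned: "T \<in> aligned \<mu> \<longleftrightarrow> (\<exists>v. unit \<mu> T v)" for \<mu> T
  proof
    assume "T \<in> aligned \<mu>"
    then obtain v where v: "\<And>i. v $ i \<ge> 0" "v \<noteq> 0" "pencil A T \<mu> *v v = 0"
      by (auto simp: aligned_def)
    then have "unit \<mu> T ((1 / norm v) *\<^sub>R v)"
      by (simp add: unit_def matrix_vector_mult_scaleR)
    then show "\<exists>v. unit \<mu> T v" by blast
  qed (force simp: aligned_def unit_def)
  \<comment> \<open>The kernel is a line; unit norm fixes the multiple up to sign, and nonnegativity
    fixes the sign.\<close>
  have unique: "v = w" if "\<mu> \<ge> 0" and v: "unit \<mu> T v" and w: "unit \<mu> T w" for \<mu> T v w
  proof -
    have v0: "v \<noteq> 0" using v by (auto simp: unit_def)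
    obtain c where c: "w = c *\<^sub>R v"
      using kernel_unique[of \<mu> v T w] v w v0 \<open>\<mu> \<ge> 0\<close> unfolding unit_def by metis
    have "\<bar>c\<bar> = 1" using v w by (auto simp: unit_def c)
    moreover have "v $ i > 0" for i
      using kernel_pos[of \<mu> v T i] v v0 \<open>\<mu> \<ge> 0\<close> by (auto simp: unit_def)
    then have "c \<ge> 0" using w by (auto simp: unit_def c zero_le_mult_iff not_le)
       (meson not_le order_less_le)
    ultimately show ?thesis by (simp add: c)
  qed
  have values_eq: "lcp_aligned_values M = {\<mu>. \<mu> \<ge> 0 \<and> aligned \<mu> \<noteq> {}}"
    by (auto simp: lcp_aligned_values_def trio aligned ex_in_conv[symmetric])
  have pairs: "finite (lcp_aligned_pairs M \<mu>) \<and> lcp_multiplicity M \<mu> = card (aligned \<mu>)"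
    if \<mu>: "\<mu> \<ge> 0" for \<mu>
  proof -
    \<comment> \<open>On \<open>aligned \<mu>\<close> the unit vector is a function of the pattern,
      so \<open>f\<close> enumerates the pairs. Injectivity comes from the first component.\<close>
    define f where "f T = (sign_matrix T, THE v. unit \<mu> T v)" for T
    have the: "(THE v. unit \<mu> T v) = v" if "unit \<mu> T v" for T v
      using that unique[OF \<mu>] by blast
    have f: "f T = (sign_matrix T, v)" if "unit \<mu> T v" for T v
      using the[OF that] by (simp add: f_def)
    have "lcp_aligned_pairs M \<mu> = {(sign_matrix T, v) | T v. unit \<mu> T v}"
      using \<mu> by (auto simp: lcp_aligned_pairs_def trio)
    also have "\<dots> = f ` aligned \<mu>"
    proof (intro set_eqI iffI)
      fix p assume "p \<in> {(sign_matrix T, v) | T v. unit \<mu> T v}"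
      then show "p \<in> f ` aligned \<mu>" using f aligned by force
    next
      fix p assume "p \<in> f ` aligned \<mu>"
      then show "p \<in> {(sign_matrix T, v) | T v. unit \<mu> T v}" using f aligned by force
    qed
    finally have "lcp_aligned_pairs M \<mu> = f ` aligned \<mu>" .
    moreover have "inj f"
      using inj_sign_matrix by (auto simp: inj_def f_def)
    ultimately show ?thesis
      by (simp add: lcp_multiplicity_def card_image inj_on_subset)
  qed
  \<comment> \<open>In dimension one, 0 being aligned forces the single entry of \<open>A\<close> to
    vanish, which means \<open>M = mat 1\<close>.\<close>
  have small: "aligned 0 = {} \<or> CARD('n) \<ge> 2"
  proof (rule ccontr)
    assume "\<not> ?thesis"
    then obtain T where T: "T \<in> aligned 0" and n: "CARD('n) < 2" by auto
    obtain v where v: "\<And>i. v $ i \<ge> 0" "v \<noteq> 0" "pencil A T 0 *v v = 0"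
      using T by (auto simp: aligned_def)
    have pos: "v $ i > 0" for i by (rule kernel_pos[OF _ v]) simp
    have "CARD('n) = 1" using n by (simp add: less_2_cases_iff)
    then obtain a where a: "(UNIV :: 'n set) = {a}" by (rule card_1_singletonE)
    then have eq: "i = a" for i by blast
    have "(A *v v) $ a = 0" using v(3) by (simp add: pencil_0_mult)
    then have "A $ a $ a = 0" using pos[of a] by (simp add: matrix_vector_mult_def a)
    then have "A = 0" using eq by (metis vec_eq_iff zero_index)
    then have "M - mat 1 = 0" using NA by simp
    then show False using assms(2) by simp
  qed
  let ?V = "{t. t > 0 \<and> aligned t \<noteq> {}}"
  have fin: "finite (lcp_aligned_values M)"
    unfolding values_eq by (rule finite_subset[OF _ finite_aligned]) auto
  have "(\<Sum>\<mu> \<in> lcp_aligned_values M. lcp_multiplicity M \<mu>) = (\<Sum>\<mu> \<in> lcp_aligned_values M. card (aligned \<mu>))"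
    by (rule sum.cong) (auto simp: values_eq pairs)
  \<comment> \<open>Including 0 contributes an empty count if 0 is not an aligned value, and allows
    the term at 0 to be split off.\<close>
  also have "\<dots> = (\<Sum>\<mu> \<in> {\<mu>. \<mu> \<ge> 0 \<and> aligned \<mu> \<noteq> {}} \<union> {0}. card (aligned \<mu>))"
    unfolding values_eq by (rule sum.mono_neutral_left) (use fin in \<open>auto simp: values_eq\<close>)
  also have "{\<mu>. \<mu> \<ge> 0 \<and> aligned \<mu> \<noteq> {}} \<union> {0} = insert 0 ?V" by auto
  also have "(\<Sum>\<mu> \<in> insert 0 ?V. card (aligned \<mu>)) = card (aligned 0) + (\<Sum>\<mu> \<in> ?V. card (aligned \<mu>))"
    by (rule sum.insert) (use fin in \<open>auto simp: values_eq elim: rev_finite_subset\<close>)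
  \<comment> \<open>The term at 0 counts either no patterns or all \<open>2 ^ CARD('n)\<close> of
    them, so it is even and the positive values decide the parity.\<close>
  finally have "odd (\<Sum>\<mu> \<in> lcp_aligned_values M. lcp_multiplicity M \<mu>)"
    using odd_sum_card_aligned[OF small] aligned_0 by (auto simp: card_UNIV_set)
  then show ?thesis using fin pairs by (auto simp: values_eq)
qed

end
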